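(* Let $D\subseteq D'\subseteq\mathbb{R}^+$ with $\inf D>0$ and $\inf D'=0$. Let $(r_n)_{n\in\omega}$ be a strictly decreasing sequence in $D'$ coinitial in $D'$ with $r_0<\inf D$, and let $(\bar U,\bar d)$ be a strongly rigid perfect compact Polish ultrametric space with distance set $\{r_n:n\in\omega\}$. Define $\mathbf{U}\colon\mathbf{U}_D\to\mathbf{U}_{D'}$ by letting $\mathbf{U}(U)$, for $(U,d)\in\mathbf{U}_D$, be $U\times\bar U$ with the ultrametric $\hat d((x,y),(x',y'))=d(x,x')$ if $x\ne x'$ and $\hat d((x,y),(x',y'))=\bar d(y,y')$ if $x=x'$; and for an isometric embedding $\psi\colon U\to U'$ let $\mathbf{U}(\psi)(x,y)=(\psi(x),y)$. Then $\mathbf{U}$ is a categorical full embedding, and for every $U\in\mathbf{U}_D$ the space $\mathbf{U}(U)$ is perfect and locally compact with $\operatorname{weight}(\mathbf{U}(U))=\max\{|U|,\aleph_0\}$.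
   Context: For $D\subseteq\mathbb{R}^+=\{r\in\mathbb{R}:r>0\}$, $\mathbf{U}_D$ is the category whose objects are nonempty complete ultrametric spaces whose distance set $\{d(x,x'):x,x'\in X\}\setminus\{0\}$ is contained in $D$, and whose arrows are isometric embeddings. A metric space is strongly rigid if the only isometric embedding of it into itself is the identity. A categorical full embedding is a functor that is faithful, full, and injective on objects. $\operatorname{weight}$ denotes the minimal cardinality of a base of the topology. *)

theory Defs
  imports "HOL-Analysis.Analysis"
begin

unbundle cardinal_syntax

section \<open>Categories, functors, full embeddings\<close>

record ('o, 'm) precat =
  Obj :: "'o set"
  Arr :: "'m set"
  Dom :: "'m \<Rightarrow> 'o"
  Cod :: "'m \<Rightarrow> 'o"
  Ident :: "'o \<Rightarrow> 'm"
  Comp :: "'m \<Rightarrow> 'm \<Rightarrow> 'm"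

definition Hom :: "('o, 'm) precat \<Rightarrow> 'o \<Rightarrow> 'o \<Rightarrow> 'm set" where
  "Hom C X Y = {f \<in> Arr C. Dom C f = X \<and> Cod C f = Y}"

text \<open>\<open>Comp C g f\<close> is ``\<open>g\<close> after \<open>f\<close>''; it is only meaningful when \<open>Dom C g = Cod C f\<close>.\<close>

definition is_category :: "('o, 'm) precat \<Rightarrow> bool" where
  "is_category C \<longleftrightarrow>
     (\<forall>f \<in> Arr C. Dom C f \<in> Obj C \<and> Cod C f \<in> Obj C) \<and>
     (\<forall>X \<in> Obj C. Ident C X \<in> Hom C X X) \<and>
     (\<forall>f \<in> Arr C. \<forall>g \<in> Arr C. Dom C g = Cod C f \<longrightarrow>
        Comp C g f \<in> Hom C (Dom C f) (Cod C g)) \<and>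
     (\<forall>f \<in> Arr C. Comp C f (Ident C (Dom C f)) = f \<and> Comp C (Ident C (Cod C f)) f = f) \<and>
     (\<forall>f \<in> Arr C. \<forall>g \<in> Arr C. \<forall>h \<in> Arr C. Dom C g = Cod C f \<longrightarrow> Dom C h = Cod C g \<longrightarrow>
        Comp C h (Comp C g f) = Comp C (Comp C h g) f)"

definition is_functor ::
  "('o, 'm) precat \<Rightarrow> ('p, 'n) precat \<Rightarrow> ('o \<Rightarrow> 'p) \<Rightarrow> ('m \<Rightarrow> 'n) \<Rightarrow> bool" where
  "is_functor C C' Fo Fa \<longleftrightarrow>
     is_category C \<and> is_category C' \<and>
     (\<forall>X \<in> Obj C. Fo X \<in> Obj C') \<and>
     (\<forall>f \<in> Arr C. Fa f \<in> Hom C' (Fo (Dom C f)) (Fo (Cod C f))) \<and>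
     (\<forall>X \<in> Obj C. Fa (Ident C X) = Ident C' (Fo X)) \<and>
     (\<forall>f \<in> Arr C. \<forall>g \<in> Arr C. Dom C g = Cod C f \<longrightarrow>
        Fa (Comp C g f) = Comp C' (Fa g) (Fa f))"

definition faithful_on_homs ::
  "('o, 'm) precat \<Rightarrow> ('m \<Rightarrow> 'n) \<Rightarrow> bool" where
  "faithful_on_homs C Fa \<longleftrightarrow> (\<forall>X \<in> Obj C. \<forall>Y \<in> Obj C. inj_on Fa (Hom C X Y))"

definition full_on_homs ::
  "('o, 'm) precat \<Rightarrow> ('p, 'n) precat \<Rightarrow> ('o \<Rightarrow> 'p) \<Rightarrow> ('m \<Rightarrow> 'n) \<Rightarrow> bool" where
  "full_on_homs C C' Fo Fa \<longleftrightarrow>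
     (\<forall>X \<in> Obj C. \<forall>Y \<in> Obj C. Hom C' (Fo X) (Fo Y) \<subseteq> Fa ` Hom C X Y)"

definition categorical_full_embedding ::
  "('o, 'm) precat \<Rightarrow> ('p, 'n) precat \<Rightarrow> ('o \<Rightarrow> 'p) \<Rightarrow> ('m \<Rightarrow> 'n) \<Rightarrow> bool" where
  "categorical_full_embedding C C' Fo Fa \<longleftrightarrow>
     is_functor C C' Fo Fa \<and> faithful_on_homs C Fa \<and> full_on_homs C C' Fo Fa \<and>
     inj_on Fo (Obj C)"


section \<open>Ultrametric spaces and isometric embeddings\<close>

definition ultrametric :: "'a metric \<Rightarrow> bool" where
  "ultrametric X \<longleftrightarrow> (\<forall>x \<in> mspace X. \<forall>y \<in> mspace X. \<forall>z \<in> mspace X.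
     mdist X x z \<le> max (mdist X x y) (mdist X y z))"

definition distance_set :: "'a metric \<Rightarrow> real set" where
  "distance_set X = {mdist X x x' | x x'. x \<in> mspace X \<and> x' \<in> mspace X} - {0}"

definition isometric_embedding :: "'a metric \<Rightarrow> 'b metric \<Rightarrow> ('a \<Rightarrow> 'b) \<Rightarrow> bool" where
  "isometric_embedding X Y f \<longleftrightarrow> f \<in> mspace X \<rightarrow> mspace Y \<and>
     (\<forall>x \<in> mspace X. \<forall>x' \<in> mspace X. mdist Y (f x) (f x') = mdist X x x')"

definition strongly_rigid :: "'a metric \<Rightarrow> bool" where
  "strongly_rigid X \<longleftrightarrow> (\<forall>f. isometric_embedding X X f \<longrightarrow> (\<forall>x \<in> mspace X. f x = x))"

definition polish_metric :: "'a metric \<Rightarrow> bool" where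
  "polish_metric X \<longleftrightarrow> mcomplete_of X \<and> separable_space (mtopology_of X)"

text \<open>Perfect: no isolated points.\<close>

definition perfect_topology :: "'a topology \<Rightarrow> bool" where
  "perfect_topology T \<longleftrightarrow> T derived_set_of topspace T = topspace T"


section \<open>The category of complete ultrametric spaces with distances in \<open>D\<close>\<close>

text \<open>The distance function of an element of \<^typ>\<open>'a metric\<close> is a total function, with arbitrary
  values off the carrier. Objects are required to have distance \<open>0\<close> off the carrier, so that
  equality of objects is equality of metric spaces (same points, same distances on them).\<close>

definition canonical_off_carrier :: "'a metric \<Rightarrow> bool" where
  "canonical_off_carrier X \<longleftrightarrow>
     (\<forall>x y. x \<notin> mspace X \<or> y \<notin> mspace X \<longrightarrow> mdist X x y = 0)"

text \<open>An arrow \<open>(X, f, Y)\<close> carries its domain and codomain, and \<open>f\<close> is extensional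
  (\<^term>\<open>undefined\<close> off the carrier of \<open>X\<close>), so that equality of arrows is equality of maps.\<close>

type_synonym 'a marrow = "'a metric \<times> ('a \<Rightarrow> 'a) \<times> 'a metric"

definition ultra_objects :: "real set \<Rightarrow> 'a metric set" where
  "ultra_objects D = {X. mspace X \<noteq> {} \<and> mcomplete_of X \<and> ultrametric X \<and>
     distance_set X \<subseteq> D \<and> canonical_off_carrier X}"

definition ultra_cat :: "real set \<Rightarrow> ('a metric, 'a marrow) precat" where
  "ultra_cat D = \<lparr>
     Obj = ultra_objects D,
     Arr = {(X, f, Y). X \<in> ultra_objects D \<and> Y \<in> ultra_objects D \<and>
              isometric_embedding X Y f \<and> f \<in> extensional (mspace X)},
     Dom = (\<lambda>(X, f, Y). X),
     Cod = (\<lambda>(X, f, Y). Y),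
     Ident = (\<lambda>X. (X, restrict id (mspace X), X)),
     Comp = (\<lambda>(Y, g, Z) (X, f, Y'). (X, compose (mspace X) g f, Z)) \<rparr>"


section \<open>The functor\<close>

definition fibre_dist :: "'a metric \<Rightarrow> 'b metric \<Rightarrow> 'a \<times> 'b \<Rightarrow> 'a \<times> 'b \<Rightarrow> real" where
  "fibre_dist X B = (\<lambda>(x, y) (x', y').
     if (x, y) \<in> mspace X \<times> mspace B \<and> (x', y') \<in> mspace X \<times> mspace B
     then (if x \<noteq> x' then mdist X x x' else mdist B y y')
     else 0)"

text \<open>As with any use of \<^const>\<open>metric\<close>, this is meaningful only if \<^const>\<open>fibre_dist\<close> is a
  metric; see \<open>fibre_dist_metric\<close> below.\<close>

definition U_obj :: "'b metric \<Rightarrow> 'a metric \<Rightarrow> ('a \<times> 'b) metric" where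
  "U_obj B X = metric (mspace X \<times> mspace B, fibre_dist X B)"

definition U_arr :: "'b metric \<Rightarrow> 'a marrow \<Rightarrow> ('a \<times> 'b) marrow" where
  "U_arr B = (\<lambda>(X, f, Y).
     (U_obj B X, restrict (\<lambda>(x, y). (f x, y)) (mspace X \<times> mspace B), U_obj B Y))"

lemma fibre_dist_metric:
  assumes "ultrametric X" "ultrametric B"
    and less: "\<And>x x' y y'. \<lbrakk>x \<in> mspace X; x' \<in> mspace X; x \<noteq> x'; y \<in> mspace B; y' \<in> mspace B\<rbrakk>
      \<Longrightarrow> mdist B y y' < mdist X x x'"
  shows "Metric_space (mspace X \<times> mspace B) (fibre_dist X B)"
proof
  show "0 \<le> fibre_dist X B p q" for p q
    by (auto simp: fibre_dist_def split: prod.splits)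
  show "fibre_dist X B p q = fibre_dist X B q p" for p q
    by (auto simp: fibre_dist_def mdist_commute split: prod.splits)
  show "fibre_dist X B p q = 0 \<longleftrightarrow> p = q"
    if "p \<in> mspace X \<times> mspace B" "q \<in> mspace X \<times> mspace B" for p q
    using that by (auto simp: fibre_dist_def split: if_splits)
  show "fibre_dist X B p s \<le> fibre_dist X B p q + fibre_dist X B q s"
    if "p \<in> mspace X \<times> mspace B" "q \<in> mspace X \<times> mspace B" "s \<in> mspace X \<times> mspace B" for p q s
  proof -
    obtain x y x' y' z w where [simp]: "p = (x, y)" "q = (x', y')" "s = (z, w)"
      by (metis surj_pair)
    have tri: "mdist X x z \<le> mdist X x x' + mdist X x' z" "mdist B y w \<le> mdist B y y' + mdist B y' w"
      using that by (auto intro: mdist_triangle)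
    have "mdist B y w \<le> mdist X x x' + mdist X x' x" if "x \<noteq> x'"
      using less[of x x' y w] that \<open>p \<in> _\<close> \<open>q \<in> _\<close> \<open>s \<in> _\<close> mdist_nonneg[of X x' x]
      by (simp add: order.strict_implies_order add_increasing2)
    then show ?thesis
      using that tri by (auto simp: fibre_dist_def)
  qed
qed


section \<open>Weight\<close>

definition is_base :: "'a topology \<Rightarrow> 'a set set \<Rightarrow> bool" where
  "is_base T \<B> \<longleftrightarrow> (\<forall>V \<in> \<B>. openin T V) \<and> (\<forall>W. openin T W \<longrightarrow> (\<exists>\<C> \<subseteq> \<B>. W = \<Union>\<C>))"

definition min_base :: "'a topology \<Rightarrow> 'a set set \<Rightarrow> bool" where
  "min_base T \<B> \<longleftrightarrow> is_base T \<B> \<and> (\<forall>\<B>'. is_base T \<B>' \<longrightarrow> |\<B>| \<le>o |\<B>'| )"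

definition weight :: "'a topology \<Rightarrow> 'a set rel" where
  "weight T = |SOME \<B>. min_base T \<B>|"

lemma min_base_exists: "\<exists>\<B>. min_base T \<B>"
proof -
  have "is_base T {V. openin T V}"
    unfolding is_base_def by (metis (no_types) Collect_mem_eq ccpo_Sup_singleton empty_subsetI
        insert_subset mem_Collect_eq)
  then have "\<exists>r \<in> card_of ` {\<B>. is_base T \<B>}. \<forall>r' \<in> card_of ` {\<B>. is_base T \<B>}. r \<le>o r'"
    by (intro exists_minim_Well_order) (auto intro: card_of_Well_order)
  then show ?thesis
    by (auto simp: min_base_def)
qed

text \<open>Maximum of two cardinals living on possibly different types.\<close>

definition card_max :: "'a rel \<Rightarrow> 'b rel \<Rightarrow> ('a + 'b) rel" where
  "card_max r s = (if r \<le>o s then |Inr ` Field s| else |Inl ` Field r| )"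

end

theory Submission
  imports Defs "HOL-Library.Countable_Set_Type"
begin

text \<open>Points in different fibres are more than \<open>r 0\<close> apart, points in one fibre at most \<open>r 0\<close>.
  Hence an isometric embedding \<open>\<phi>\<close> of \<open>U \<times> Ubar\<close> into \<open>U' \<times> Ubar\<close> maps each fibre into a fibre,
  by strong rigidity it does so identically, and \<open>\<phi> (x, y) = (f x, y)\<close> for an isometric
  embedding \<open>f\<close> of \<open>U\<close> into \<open>U'\<close>. Topologically the space is a disjoint sum of
  \<open>|U|\<close> copies of \<open>Ubar\<close>.\<close>

section \<open>Weight\<close>

text \<open>The neighbourhood form is easier to verify and to apply; for the converse, an open
  \<open>W\<close> is the union of all members of the family that lie inside it.\<close>

lemma is_base_iff:
  "is_base T \<B> \<longleftrightarrow> (\<forall>V \<in> \<B>. openin T V) \<and>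
     (\<forall>W p. openin T W \<longrightarrow> p \<in> W \<longrightarrow> (\<exists>V \<in> \<B>. p \<in> V \<and> V \<subseteq> W))" (is "?L \<longleftrightarrow> ?R")
proof
  assume L: ?L
  have "\<exists>V \<in> \<B>. p \<in> V \<and> V \<subseteq> W" if W: "openin T W" and p: "p \<in> W" for W p
  proof -
    obtain \<C> where "\<C> \<subseteq> \<B>" "W = \<Union>\<C>"
      using L W unfolding is_base_def by metis
    then show ?thesis
      using p by blast
  qed
  then show ?R
    using L unfolding is_base_def by blast
next
  assume R: ?R
  have "\<exists>\<C> \<subseteq> \<B>. W = \<Union>\<C>" if W: "openin T W" for W
  proof (intro exI conjI)
    show "{V \<in> \<B>. V \<subseteq> W} \<subseteq> \<B>"
      by blast
    show "W = \<Union>{V \<in> \<B>. V \<subseteq> W}"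
      using R W by blast
  qed
  then show ?L
    using R unfolding is_base_def by blast
qed

text \<open>The minimal base \<open>\<M>\<close> picked by \<open>weight\<close> is squeezed: it is
  at most as large as the given base, hence at most \<open>r\<close>, and as a base it has size at
  least \<open>r\<close>. The cardinal \<open>r\<close> may live on another type, so it can be
  \<open>natLeq\<close> as well as the size of a set of points.\<close>

lemma weight_eqI:
  fixes r :: "'c rel"
  assumes "Card_order r"
    and "is_base T \<B>" "|\<B>| \<le>o r"
    and lower: "\<And>\<B>'. is_base T \<B>' \<Longrightarrow> r \<le>o |\<B>'|"
  shows "weight T =o r"
proof -
  define \<M> where "\<M> = (SOME \<B>. min_base T \<B>)"
  have M: "min_base T \<M>"
    unfolding \<M>_def by (rule someI_ex) (rule min_base_exists)
  then have "|\<M>| \<le>o |\<B>|" "r \<le>o |\<M>|"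
    using assms(2) lower by (auto simp: min_base_def)
  then have "|\<M>| =o r"
    using assms(3) ordIso_iff_ordLeq ordLeq_transitive by blast
  then show ?thesis
    by (simp add: weight_def \<M>_def)
qed

text \<open>In a T1 space the complements of points are open and pairwise distinct, and each is a
  union of base members. A finite base has only finitely many such unions.\<close>

lemma infinite_base:
  assumes "is_base T \<B>" and "t1_space T" and "infinite (topspace T)"
  shows "infinite \<B>"
proof
  assume fin: "finite \<B>"
  have "(\<lambda>p. topspace T - {p}) ` topspace T \<subseteq> Union ` Pow \<B>"
  proof (clarify)
    fix p assume "p \<in> topspace T"
    then have "openin T (topspace T - {p})"
      using assms(2) by (simp add: t1_space_openin_delete_alt)
    then obtain \<C> where "\<C> \<subseteq> \<B>" "topspace T - {p} = \<Union>\<C>"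
      using assms(1) unfolding is_base_def by metis
    then show "topspace T - {p} \<in> Union ` Pow \<B>"
      by blast
  qed
  then have "finite ((\<lambda>p. topspace T - {p}) ` topspace T)"
    by (rule finite_subset) (simp add: fin)
  moreover have "inj_on (\<lambda>p. topspace T - {p}) (topspace T)"
    by (auto simp: inj_on_def)
  ultimately show False
    using assms(3) finite_imageD by blast
qed

section \<open>Evaluating the maximum of a cardinal with aleph-zero\<close>

lemma card_of_inj_image:
  assumes "inj_on f A"
  shows "|f ` A| =o |A|"
  using assms card_of_ordIsoI[OF bij_betw_imageI[OF assms refl]] ordIso_symmetric by metis

text \<open>Countability is exactly the test made in \<open>card_max\<close>, so here it returns the
  \<open>Inr\<close> copy of the naturals; the uncountable case returns the \<open>Inl\<close> copy
  of \<open>A\<close>.\<close>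

lemma card_max_natLeq_countable:
  fixes A :: "'a set"
  assumes "countable A"
  shows "card_max |A| natLeq =o natLeq"
proof -
  have "|(Inr :: nat \<Rightarrow> 'a + nat) ` UNIV| =o natLeq"
    by (rule ordIso_transitive[OF card_of_inj_image card_of_nat]) simp
  then show ?thesis
    using assms by (simp add: card_max_def countable_card_le_natLeq Field_natLeq)
qed

lemma card_max_natLeq_uncountable:
  fixes A :: "'a set"
  assumes "uncountable A"
  shows "card_max |A| natLeq =o |A|"
proof -
  have "|(Inl :: 'a \<Rightarrow> 'a + nat) ` A| =o |A|"
    by (rule card_of_inj_image) simp
  then show ?thesis
    using assms by (simp add: card_max_def countable_card_le_natLeq Field_card_of)
qed

section \<open>Spaces with thin fibres\<close>

lemma fibre_dist_same:
  assumes "x \<in> mspace X" "y \<in> mspace B" "y' \<in> mspace B"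
  shows "fibre_dist X B (x, y) (x, y') = mdist B y y'"
  using assms by (simp add: fibre_dist_def)

text \<open>The threshold \<open>\<delta>\<close> separates the two kinds of distances. Being
  positive, it also serves as a ball radius, which makes the fibres open.\<close>

locale thin_fibres =
  fixes X :: "'a metric" and B :: "'b metric" and \<delta> :: real
  assumes ultra_X: "ultrametric X"
    and ultra_B: "ultrametric B"
    and delta_pos: "0 < \<delta>"
    and dist_B: "\<lbrakk>y \<in> mspace B; y' \<in> mspace B\<rbrakk> \<Longrightarrow> mdist B y y' \<le> \<delta>"
    and dist_X: "\<lbrakk>x \<in> mspace X; x' \<in> mspace X; x \<noteq> x'\<rbrakk> \<Longrightarrow> \<delta> < mdist X x x'"
begin

sublocale F: Metric_space "mspace X \<times> mspace B" "fibre_dist X B"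
  using fibre_dist_metric[OF ultra_X ultra_B] dist_B dist_X by (meson order.strict_trans1)

sublocale B: Metric_space "mspace B" "mdist B"
  by simp

lemma mspace_U_obj [simp]: "mspace (U_obj B X) = mspace X \<times> mspace B"
  by (simp add: U_obj_def)

lemma mdist_U_obj [simp]: "mdist (U_obj B X) = fibre_dist X B"
  by (simp add: U_obj_def)

lemma mtopology_U_obj: "mtopology_of (U_obj B X) = F.mtopology"
  by (simp add: U_obj_def)

text \<open>This recovers the partition into fibres from the metric alone, so isometric embeddings
  must respect it.\<close>

lemma fibre_dist_le_iff:
  assumes "x \<in> mspace X" "x' \<in> mspace X" "y \<in> mspace B" "y' \<in> mspace B"
  shows "fibre_dist X B (x, y) (x', y') \<le> \<delta> \<longleftrightarrow> x = x'"
  using assms dist_B[of y y'] dist_X[of x x'] by (auto simp: fibre_dist_def)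

section \<open>The fibred space as a complete ultrametric space\<close>

text \<open>The mixed case is \<open>x = z\<close> and \<open>x' \<noteq> x\<close>: a distance
  inside a fibre is at most \<open>\<delta>\<close>, and the detour through another fibre costs more
  than \<open>\<delta>\<close>. The other cases reduce to the inequality in \<open>X\<close> or in
  \<open>B\<close>.\<close>

lemma ultrametric_U_obj: "ultrametric (U_obj B X)"
  unfolding ultrametric_def mspace_U_obj mdist_U_obj
proof (intro ballI)
  fix p q s
  assume "p \<in> mspace X \<times> mspace B" "q \<in> mspace X \<times> mspace B" "s \<in> mspace X \<times> mspace B"
  then obtain x y x' y' z w where e: "p = (x, y)" "q = (x', y')" "s = (z, w)"
    and m: "x \<in> mspace X" "x' \<in> mspace X" "z \<in> mspace X"
      "y \<in> mspace B" "y' \<in> mspace B" "w \<in> mspace B"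
    by blast
  have u: "mdist X x z \<le> max (mdist X x x') (mdist X x' z)"
    "mdist B y w \<le> max (mdist B y y') (mdist B y' w)"
    using ultra_X ultra_B m by (auto simp: ultrametric_def)
  show "fibre_dist X B p s \<le> max (fibre_dist X B p q) (fibre_dist X B q s)"
    using m u dist_B[of y w] dist_X[of x x'] dist_X[of x' z] by (auto simp: e fibre_dist_def)
qed

lemma distance_set_U_obj: "distance_set (U_obj B X) \<subseteq> distance_set X \<union> distance_set B"
  unfolding distance_set_def mspace_U_obj mdist_U_obj
  by (auto simp: fibre_dist_def)

lemma canonical_U_obj: "canonical_off_carrier (U_obj B X)"
  unfolding canonical_off_carrier_def mspace_U_obj mdist_U_obj
  by (auto simp: fibre_dist_def)

text \<open>Once its terms are less than \<open>\<delta>\<close> apart, a Cauchy sequence stays in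
  one fibre; there it is a Cauchy sequence of \<open>B\<close>, whose completeness supplies the
  limit.\<close>

lemma mcomplete_U_obj:
  assumes "mcomplete_of B"
  shows "mcomplete_of (U_obj B X)"
proof -
  have "F.mcomplete"
    unfolding F.mcomplete_def
  proof (intro allI impI)
    fix \<sigma> :: "nat \<Rightarrow> 'a \<times> 'b" assume \<sigma>: "F.MCauchy \<sigma>"
    have mem: "\<sigma> n \<in> mspace X \<times> mspace B" for n
      using \<sigma> by (auto simp: F.MCauchy_def)
    then have memX: "fst (\<sigma> n) \<in> mspace X" and memB: "snd (\<sigma> n) \<in> mspace B" for n
      by (metis mem_Times_iff)+
    obtain N where N: "\<And>n m. \<lbrakk>N \<le> n; N \<le> m\<rbrakk> \<Longrightarrow> fibre_dist X B (\<sigma> n) (\<sigma> m) < \<delta>"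
      using \<sigma> delta_pos unfolding F.MCauchy_def by meson
    define x where "x = fst (\<sigma> N)"
    have fst: "fst (\<sigma> n) = x" if "N \<le> n" for n
    proof -
      have "fibre_dist X B (fst (\<sigma> n), snd (\<sigma> n)) (fst (\<sigma> N), snd (\<sigma> N)) \<le> \<delta>"
        using N[OF that order_refl] by simp
      then show ?thesis
        unfolding x_def using fibre_dist_le_iff memX memB by metis
    qed
    have same: "fibre_dist X B (\<sigma> n) (x, y) = mdist B (snd (\<sigma> n)) y"
      if "N \<le> n" "y \<in> mspace B" for n y
      using fst[OF that(1)] memX[of n] memB[of n] that(2) by (cases "\<sigma> n") (auto simp: fibre_dist_def)
    \<comment> \<open>Dropping the first \<open>N\<close> terms leaves a sequence that lies entirely
      in the fibre over \<open>x\<close>, where distances are those of \<open>B\<close>; the shift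
      is undone at the end, since it does not affect convergence.\<close>
    define \<tau> where "\<tau> = (\<lambda>n. snd (\<sigma> (n + N)))"
    have "B.MCauchy \<tau>"
      unfolding B.MCauchy_def
    proof (intro conjI allI impI)
      show "range \<tau> \<subseteq> mspace B"
        using memB by (auto simp: \<tau>_def)
      fix \<epsilon> :: real assume "0 < \<epsilon>"
      then obtain K where K: "\<And>n m. \<lbrakk>K \<le> n; K \<le> m\<rbrakk> \<Longrightarrow> fibre_dist X B (\<sigma> n) (\<sigma> m) < \<epsilon>"
        using \<sigma> unfolding F.MCauchy_def by meson
      have "mdist B (\<tau> n) (\<tau> m) < \<epsilon>" if "K \<le> n" "K \<le> m" for n m
      proof -
        have "\<sigma> (m + N) = (x, \<tau> m)"
          using fst[of "m + N"] by (simp add: \<tau>_def prod_eq_iff)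
        then show ?thesis
          using K[of "n + N" "m + N"] same[of "n + N" "\<tau> m"] memB that by (simp add: \<tau>_def)
      qed
      then show "\<exists>K. \<forall>n n'. K \<le> n \<longrightarrow> K \<le> n' \<longrightarrow> mdist B (\<tau> n) (\<tau> n') < \<epsilon>"
        by blast
    qed
    then obtain y where y: "limitin B.mtopology \<tau> y sequentially"
      using assms unfolding mcomplete_of_def B.mcomplete_def by blast
    then have yB: "y \<in> mspace B"
      by (simp add: B.limitin_metric)
    have "limitin F.mtopology \<sigma> (x, y) sequentially"
      unfolding F.limitin_metric
    proof (intro conjI allI impI)
      show "(x, y) \<in> mspace X \<times> mspace B"
        using yB memX by (simp add: x_def)
      fix \<epsilon> :: real assume "0 < \<epsilon>"
      then have "\<forall>\<^sub>F n in sequentially. mdist B (\<tau> n) y < \<epsilon>"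
        using y by (auto simp: B.limitin_metric elim: eventually_mono)
      then have "\<forall>\<^sub>F n in sequentially. fibre_dist X B (\<sigma> (n + N)) (x, y) < \<epsilon>"
        by (rule eventually_mono) (simp add: same yB \<tau>_def)
      then have "\<forall>\<^sub>F n in sequentially. fibre_dist X B (\<sigma> n) (x, y) < \<epsilon>"
        by (rule eventually_sequentially_seg[THEN iffD1])
      then show "\<forall>\<^sub>F n in sequentially. \<sigma> n \<in> mspace X \<times> mspace B \<and> fibre_dist X B (\<sigma> n) (x, y) < \<epsilon>"
        using mem by simp
    qed
    then show "\<exists>l. limitin F.mtopology \<sigma> l sequentially"
      by blast
  qed
  then show ?thesis
    by (simp add: U_obj_def)
qed

section \<open>Topology of the fibres\<close>

text \<open>Other fibres are more than \<open>\<delta>\<close> away, so a ball of radius at most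
  \<open>\<delta>\<close> cannot leave its own fibre.\<close>

lemma mball_fibre:
  assumes "x \<in> mspace X" "\<epsilon> \<le> \<delta>"
  shows "F.mball (x, y) \<epsilon> = {x} \<times> B.mball y \<epsilon>"
proof -
  have "(x', y') \<in> F.mball (x, y) \<epsilon> \<longleftrightarrow> x' = x \<and> y' \<in> B.mball y \<epsilon>" for x' y'
  proof (cases "x' = x")
    case True
    then show ?thesis
      using assms(1) fibre_dist_same[of x X y B y'] by auto
  next
    case False
    then show ?thesis
      using assms fibre_dist_le_iff[of x x' y y'] by auto
  qed
  then show ?thesis
    by (simp add: set_eq_iff split_paired_all del: B.in_mball F.in_mball)
qed

lemma openin_fibre:
  assumes "x \<in> mspace X"
  shows "openin F.mtopology ({x} \<times> mspace B)"
  unfolding F.openin_mtopology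
proof (intro conjI allI impI)
  show "{x} \<times> mspace B \<subseteq> mspace X \<times> mspace B"
    using assms by auto
  fix p assume "p \<in> {x} \<times> mspace B"
  then have "F.mball p \<delta> \<subseteq> {x} \<times> mspace B"
    using mball_fibre[of x \<delta> "snd p"] assms by auto
  then show "\<exists>e>0. F.mball p e \<subseteq> {x} \<times> mspace B"
    using delta_pos by blast
qed

text \<open>\<open>Pair x\<close> is distance-preserving on \<open>B\<close>; its continuity
  transports compactness from \<open>B\<close> to the fibre over \<open>x\<close>.\<close>

lemma continuous_map_fibre:
  assumes "x \<in> mspace X"
  shows "continuous_map B.mtopology F.mtopology (Pair x)"
  unfolding continuous_map_def
proof (intro conjI allI impI)
  show "Pair x \<in> topspace B.mtopology \<rightarrow> topspace F.mtopology"
    using assms by auto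
  fix U assume U: "openin F.mtopology U"
  show "openin B.mtopology {y \<in> topspace B.mtopology. (x, y) \<in> U}"
    unfolding B.openin_mtopology
  proof (intro conjI allI impI)
    fix y assume "y \<in> {y \<in> topspace B.mtopology. (x, y) \<in> U}"
    then have y: "y \<in> mspace B" "(x, y) \<in> U"
      by auto
    then obtain e where e: "0 < e" "F.mball (x, y) e \<subseteq> U"
      using U unfolding F.openin_mtopology by meson
    have "(x, y') \<in> U" if "y' \<in> B.mball y e" for y'
      using that assms by (intro subsetD[OF e(2)]) (simp add: fibre_dist_same)
    then have "B.mball y e \<subseteq> {y \<in> topspace B.mtopology. (x, y) \<in> U}"
      using B.mball_subset_mspace by auto
    then show "\<exists>e>0. B.mball y e \<subseteq> {y \<in> topspace B.mtopology. (x, y) \<in> U}"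
      using e by blast
  qed auto
qed

text \<open>The fibre through a point is open and, as a continuous image of \<open>B\<close>,
  compact, so it serves both as the open neighbourhood and as the compact set containing it.\<close>

lemma locally_compact_U_obj:
  assumes "compact_space (mtopology_of B)"
  shows "locally_compact_space (mtopology_of (U_obj B X))"
  unfolding locally_compact_space_def mtopology_U_obj
proof
  fix p assume "p \<in> topspace F.mtopology"
  then have p: "fst p \<in> mspace X" "p \<in> {fst p} \<times> mspace B"
    by auto
  have "compactin B.mtopology (mspace B)"
    using assms by (simp add: compact_space_def mtopology_of_def)
  then have "compactin F.mtopology (Pair (fst p) ` mspace B)"
    using continuous_map_fibre[OF p(1)] image_compactin by blast
  moreover have "Pair (fst p) ` mspace B = {fst p} \<times> mspace B"
    by auto
  ultimately have "compactin F.mtopology ({fst p} \<times> mspace B)"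
    by simp
  then show "\<exists>U K. openin F.mtopology U \<and> compactin F.mtopology K \<and> p \<in> U \<and> U \<subseteq> K"
    using openin_fibre[OF p(1)] p(2) by (intro exI[of _ "{fst p} \<times> mspace B"] conjI) auto
qed

text \<open>A point is already approximated by other points of its own fibre, because its second
  coordinate is not isolated in \<open>B\<close>.\<close>

lemma perfect_U_obj:
  assumes "perfect_topology (mtopology_of B)"
  shows "perfect_topology (mtopology_of (U_obj B X))"
proof -
  have P: "\<exists>y' \<in> mspace B. y' \<noteq> y \<and> mdist B y y' < e" if "y \<in> mspace B" "0 < e" for y e
    using assms that unfolding perfect_topology_def mtopology_of_def
    by (auto simp: B.metric_derived_set_of set_eq_iff)
  have "\<exists>q \<in> mspace X \<times> mspace B. q \<noteq> p \<and> q \<in> F.mball p e"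
    if p: "p \<in> mspace X \<times> mspace B" and e: "0 < e" for p e
  proof -
    obtain x y where xy: "p = (x, y)" "x \<in> mspace X" "y \<in> mspace B"
      using p by blast
    obtain y' where y': "y' \<in> mspace B" "y' \<noteq> y" "mdist B y y' < e"
      using P[OF xy(3) e] by blast
    then have "(x, y') \<in> F.mball p e" "(x, y') \<noteq> p"
      using xy by (auto simp: fibre_dist_same)
    then show ?thesis
      using F.mball_subset_mspace by blast
  qed
  then show ?thesis
    unfolding perfect_topology_def mtopology_U_obj F.metric_derived_set_of by auto
qed

section \<open>Bases and weight of the fibred space\<close>

text \<open>Every first coordinate is kept as a centre, since fibres are isolated from each other;
  inside a fibre the dense set \<open>C\<close> suffices. For countable \<open>C\<close> the index
  set is \<open>mspace X\<close> times a countable set.\<close>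

lemma base_of_dense:
  assumes "C \<subseteq> mspace B" and dense: "B.mtopology closure_of C = mspace B"
  shows "is_base F.mtopology
    ((\<lambda>(x, y, n::nat). F.mball (x, y) (1 / Suc n)) ` (mspace X \<times> C \<times> UNIV))" (is "is_base _ ?\<B>")
  unfolding is_base_iff
proof (intro conjI ballI allI impI)
  fix V assume "V \<in> ?\<B>"
  then show "openin F.mtopology V"
    by auto
next
  fix W p assume W: "openin F.mtopology W" and p: "p \<in> W"
  obtain e where e: "0 < e" "F.mball p e \<subseteq> W"
    using W p unfolding F.openin_mtopology by blast
  have pM: "p \<in> mspace X \<times> mspace B"
    using W p unfolding F.openin_mtopology by blast
  then obtain x y where xy: "p = (x, y)" "x \<in> mspace X" "y \<in> mspace B"
    by blast
  \<comment> \<open>Half of \<open>e\<close> is needed because both the distance from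
    \<open>p\<close> to the new centre and the radius around that centre will be below
    \<open>1 / Suc n\<close>.\<close>
  obtain n where n: "inverse (Suc n) < e / 2"
    using reals_Archimedean[of "e / 2"] e by auto
  obtain c where c: "c \<in> C" "mdist B y c < 1 / Suc n"
    using dense xy(3) unfolding B.metric_closure_of
    by (auto simp: set_eq_iff dest!: spec[of _ y] spec[of _ "1 / Suc n"])
  have cM: "(x, c) \<in> mspace X \<times> mspace B"
    using c assms xy by auto
  have d: "fibre_dist X B (x, c) p < 1 / Suc n"
    using c xy cM by (simp add: fibre_dist_def B.commute)
  have sub: "F.mball (x, c) (1 / Suc n) \<subseteq> F.mball p e"
  proof
    fix q assume q: "q \<in> F.mball (x, c) (1 / Suc n)"
    then have "fibre_dist X B p q \<le> fibre_dist X B p (x, c) + fibre_dist X B (x, c) q"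
      using F.triangle pM cM by simp
    then have "fibre_dist X B p q < e"
      using q d n F.commute[of p] by (simp add: inverse_eq_divide)
    then show "q \<in> F.mball p e"
      using q pM by simp
  qed
  have "F.mball (x, c) (1 / Suc n) \<in> ?\<B>"
    using xy c by (intro image_eqI[of _ _ "(x, c, n)"]) auto
  moreover have "p \<in> F.mball (x, c) (1 / Suc n)"
    using d pM cM by simp
  moreover have "F.mball (x, c) (1 / Suc n) \<subseteq> W"
    using sub e(2) by (rule subset_trans)
  ultimately show "\<exists>V \<in> ?\<B>. p \<in> V \<and> V \<subseteq> W"
    by (intro bexI conjI)
qed

text \<open>Each fibre is open, so it contains a base member around its point over \<open>b\<close>.
  Fibres are disjoint and these members are nonempty, so different fibres get different
  members.\<close>

lemma card_le_base:
  assumes "is_base F.mtopology \<B>" and "mspace B \<noteq> {}"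
  shows "|mspace X| \<le>o |\<B>|"
proof -
  obtain b where b: "b \<in> mspace B"
    using assms(2) by blast
  have "\<exists>V \<in> \<B>. (x, b) \<in> V \<and> V \<subseteq> {x} \<times> mspace B" if "x \<in> mspace X" for x
    using assms(1) openin_fibre[OF that] b unfolding is_base_iff by blast
  then obtain V where V: "\<And>x. x \<in> mspace X \<Longrightarrow> V x \<in> \<B> \<and> (x, b) \<in> V x \<and> V x \<subseteq> {x} \<times> mspace B"
    by metis
  have "inj_on V (mspace X)"
    using V by (intro inj_onI) blast
  then show ?thesis
    using V card_of_ordLeq[of "mspace X" \<B>] by blast
qed

text \<open>The upper bound comes from the base of balls over a countable dense set. For the lower
  bound every base is infinite, and has at least \<open>|mspace X|\<close> members. The split on
  countability follows the branches of \<open>card_max\<close>.\<close>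

lemma weight_U_obj:
  assumes "separable_space (mtopology_of B)" and "infinite (mspace B)" and "mspace X \<noteq> {}"
  shows "weight (mtopology_of (U_obj B X)) =o card_max |mspace X| natLeq"
proof -
  obtain C where C: "countable C" "C \<subseteq> mspace B" "B.mtopology closure_of C = mspace B"
    using assms(1) by (auto simp: separable_space_def mtopology_of_def)
  define I :: "('a \<times> 'b \<times> nat) set" where "I = mspace X \<times> C \<times> UNIV"
  define \<B> where "\<B> = (\<lambda>(x, y, n::nat). F.mball (x, y) (1 / Suc n)) ` I"
  have base: "is_base F.mtopology \<B>"
    unfolding \<B>_def I_def using C by (intro base_of_dense)
  have inf: "infinite \<B>'" if "is_base F.mtopology \<B>'" for \<B>'
    using that infinite_base F.t1_space_mtopology assms(2,3) finite_cartesian_productD2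
    by (metis F.topspace_mtopology)
  have CN: "countable (C \<times> (UNIV::nat set))"
    using C by simp
  have le: "|\<B>| \<le>o |I|"
    unfolding \<B>_def by (rule card_of_image)
  show ?thesis
  proof (cases "countable (mspace X)")
    case True
    have "weight F.mtopology =o natLeq"
    proof (rule weight_eqI[OF natLeq_Card_order base])
      have "countable I"
        unfolding I_def using True CN by (rule countable_SIGMA)
      then show "|\<B>| \<le>o natLeq"
        by (simp add: \<B>_def flip: countable_card_le_natLeq)
      show "natLeq \<le>o |\<B>'|" if "is_base F.mtopology \<B>'" for \<B>'
        using inf[OF that] infinite_iff_natLeq_ordLeq by metis
    qed
    then show ?thesis
      unfolding mtopology_U_obj
      by (rule ordIso_transitive[OF _ ordIso_symmetric[OF card_max_natLeq_countable[OF True]]])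
  next
    case False
    have "weight F.mtopology =o |mspace X|"
    proof (rule weight_eqI[OF card_of_Card_order base])
      have infX: "infinite (mspace X)"
        using False countable_finite by blast
      have "natLeq \<le>o |mspace X|"
        using infX infinite_iff_natLeq_ordLeq by metis
      then have "|C \<times> (UNIV::nat set)| \<le>o |mspace X|"
        by (rule ordLeq_transitive[OF CN[unfolded countable_card_le_natLeq]])
      \<comment> \<open>Cardinal absorption: both factors of \<open>I\<close> have size at most the
        infinite cardinal \<open>|mspace X|\<close>.\<close>
      then have "|I| \<le>o |mspace X|"
        unfolding I_def using infX
        by (intro card_of_Times_ordLeq_infinite_Field[OF _ card_of_mono1[OF subset_refl]])
          (simp_all add: Field_card_of card_of_card_order_on)
      then show "|\<B>| \<le>o |mspace X|"
        by (rule ordLeq_transitive[OF le])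
      show "|mspace X| \<le>o |\<B>'|" if "is_base F.mtopology \<B>'" for \<B>'
        by (rule card_le_base[OF that]) (use assms(2) in auto)
    qed
    then show ?thesis
      unfolding mtopology_U_obj
      by (rule ordIso_transitive[OF _ ordIso_symmetric[OF card_max_natLeq_uncountable[OF False]]])
  qed
qed

end

section \<open>The functor\<close>

lemma metric_eqI:
  assumes "mspace X = mspace Y" "mdist X = mdist Y"
  shows "X = Y"
  using assms by (metis dest_metric_inverse mspace_def mdist_def prod_eq_iff)

text \<open>Cancelling the nonempty factor recovers the carrier, and distances between distinct
  points are read off over a fixed \<open>b\<close>. Equality of the total distance functions also
  concerns pairs off the carrier, where both vanish by \<open>canonical_off_carrier\<close>.\<close>

lemma U_obj_eqD:
  assumes "thin_fibres X B \<delta>" "thin_fibres Y B \<delta>" "mspace B \<noteq> {}"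
    and "canonical_off_carrier X" "canonical_off_carrier Y"
    and eq: "U_obj B X = U_obj B Y"
  shows "X = Y"
proof (rule metric_eqI)
  interpret X: thin_fibres X B \<delta> by fact
  interpret Y: thin_fibres Y B \<delta> by fact
  obtain b where b: "b \<in> mspace B"
    using assms(3) by blast
  have "mspace X \<times> mspace B = mspace Y \<times> mspace B"
    using eq X.mspace_U_obj Y.mspace_U_obj by metis
  then show M: "mspace X = mspace Y"
    using assms(3) by (auto simp: times_eq_iff)
  have F: "fibre_dist X B = fibre_dist Y B"
    using eq X.mdist_U_obj Y.mdist_U_obj by metis
  show "mdist X = mdist Y"
  proof (intro ext)
    fix x x'
    show "mdist X x x' = mdist Y x x'"
    proof (cases "x \<in> mspace X \<and> x' \<in> mspace X \<and> x \<noteq> x'")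
      case True
      then show ?thesis
        using fun_cong[OF fun_cong[OF F], of "(x, b)" "(x', b)"] M b by (simp add: fibre_dist_def)
    next
      case False
      then show ?thesis
        using assms(4,5) M unfolding canonical_off_carrier_def by (metis mdist_zero)
    qed
  qed
qed

section \<open>Isometric embeddings and the category they form\<close>

lemma isometric_embedding_inj_on:
  "isometric_embedding X Y f \<Longrightarrow> inj_on f (mspace X)"
  unfolding isometric_embedding_def inj_on_def Pi_def by (auto, metis mdist_zero)

lemma isometric_embedding_compose:
  assumes "isometric_embedding X Y f" "isometric_embedding Y Z g"
  shows "isometric_embedding X Z (compose (mspace X) g f)"
  using assms by (auto simp: isometric_embedding_def compose_def Pi_def)

lemma is_category_ultra_cat: "is_category (ultra_cat D)"
  unfolding is_category_def ultra_cat_def Hom_def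
  by (auto simp: isometric_embedding_compose compose_assoc fun_eq_iff extensional_def compose_def
      isometric_embedding_def Pi_def)

text \<open>Since \<open>f\<close> is injective, two points lie in one fibre exactly when their
  images do, so both sides use the same case of \<open>fibre_dist\<close>.\<close>

lemma isometric_embedding_U_arr:
  assumes "thin_fibres X B \<delta>" "thin_fibres Y B \<delta>" "isometric_embedding X Y f"
  shows "isometric_embedding (U_obj B X) (U_obj B Y)
    (restrict (\<lambda>(x, y). (f x, y)) (mspace X \<times> mspace B))"
proof -
  interpret X: thin_fibres X B \<delta> by fact
  interpret Y: thin_fibres Y B \<delta> by fact
  have inj: "f x = f x' \<longleftrightarrow> x = x'" if "x \<in> mspace X" "x' \<in> mspace X" for x x'
    using isometric_embedding_inj_on[OF assms(3)] that by (auto simp: inj_on_def)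
  show ?thesis
    using assms(3) inj
    unfolding isometric_embedding_def X.mspace_U_obj X.mdist_U_obj Y.mspace_U_obj Y.mdist_U_obj
    by (auto simp: fibre_dist_def Pi_def)
qed

text \<open>This is the core of fullness: \<open>\<phi>\<close> preserves the relation of being at
  most \<open>\<delta>\<close> apart, so it sends fibres into fibres, and strong rigidity fixes the
  second coordinate.\<close>

lemma isometric_embedding_U_obj_cases:
  assumes "thin_fibres X B \<delta>" "thin_fibres Y B \<delta>" "strongly_rigid B" "mspace B \<noteq> {}"
    and \<phi>: "isometric_embedding (U_obj B X) (U_obj B Y) \<phi>"
  obtains f where "isometric_embedding X Y f" "f \<in> extensional (mspace X)"
    "\<And>x y. \<lbrakk>x \<in> mspace X; y \<in> mspace B\<rbrakk> \<Longrightarrow> \<phi> (x, y) = (f x, y)"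
proof -
  interpret X: thin_fibres X B \<delta> by fact
  interpret Y: thin_fibres Y B \<delta> by fact
  obtain b where b: "b \<in> mspace B"
    using assms(4) by blast
  have mem: "fst (\<phi> (x, y)) \<in> mspace Y" "snd (\<phi> (x, y)) \<in> mspace B"
    if "x \<in> mspace X" "y \<in> mspace B" for x y
  proof -
    have "\<phi> (x, y) \<in> mspace Y \<times> mspace B"
      using \<phi> that unfolding isometric_embedding_def X.mspace_U_obj Y.mspace_U_obj by blast
    then show "fst (\<phi> (x, y)) \<in> mspace Y" "snd (\<phi> (x, y)) \<in> mspace B"
      by auto
  qed
  have iso: "fibre_dist Y B (\<phi> p) (\<phi> q) = fibre_dist X B p q"
    if "p \<in> mspace X \<times> mspace B" "q \<in> mspace X \<times> mspace B" for p q
    using \<phi> that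
    unfolding isometric_embedding_def X.mspace_U_obj X.mdist_U_obj Y.mdist_U_obj by blast
  \<comment> \<open>The base map is read off over the single point \<open>b\<close>; the next step
    shows that any other point gives the same value. The restriction makes \<open>f\<close>
    extensional, as arrows require.\<close>
  define f where "f = restrict (\<lambda>x. fst (\<phi> (x, b))) (mspace X)"
  have fst: "fst (\<phi> (x, y)) = f x" if "x \<in> mspace X" "y \<in> mspace B" for x y
  proof -
    have "fibre_dist Y B (\<phi> (x, y)) (\<phi> (x, b)) \<le> \<delta>"
      using iso[of "(x, y)" "(x, b)"] X.fibre_dist_le_iff[of x x y b] that b by simp
    then have "fst (\<phi> (x, y)) = fst (\<phi> (x, b))"
      using Y.fibre_dist_le_iff mem that b by (metis prod.collapse)
    then show ?thesis
      using that by (simp add: f_def)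
  qed
  have snd: "snd (\<phi> (x, y)) = y" if x: "x \<in> mspace X" and y: "y \<in> mspace B" for x y
  proof -
    have "mdist B (snd (\<phi> (x, y))) (snd (\<phi> (x, y'))) = mdist B y y'"
      if "y \<in> mspace B" "y' \<in> mspace B" for y y'
    proof -
      have "\<phi> (x, z) = (f x, snd (\<phi> (x, z)))" if "z \<in> mspace B" for z
        using fst[OF x that] by (simp add: prod_eq_iff)
      moreover have "f x \<in> mspace Y"
        using fst[OF x b] mem[OF x b] by simp
      ultimately have "fibre_dist Y B (\<phi> (x, y)) (\<phi> (x, y')) = mdist B (snd (\<phi> (x, y))) (snd (\<phi> (x, y')))"
        using fibre_dist_same mem[OF x] that by metis
      moreover have "fibre_dist X B (x, y) (x, y') = mdist B y y'"
        using x that by (simp add: fibre_dist_def)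
      ultimately show ?thesis
        using iso[of "(x, y)" "(x, y')"] x that by simp
    qed
    \<comment> \<open>On the fibre over \<open>x\<close>, the map \<open>\<phi>\<close> induces a
      self-embedding of \<open>B\<close>, to which strong rigidity applies.\<close>
    then have "isometric_embedding B B (\<lambda>y. snd (\<phi> (x, y)))"
      using mem x by (auto simp: isometric_embedding_def)
    then show ?thesis
      using assms(3) y unfolding strongly_rigid_def by blast
  qed
  have eq: "\<phi> (x, y) = (f x, y)" if "x \<in> mspace X" "y \<in> mspace B" for x y
    using fst[OF that] snd[OF that] by (simp add: prod_eq_iff)
  have fmem: "f x \<in> mspace Y" if "x \<in> mspace X" for x
    using fst[OF that b] mem[OF that b] by simp
  have "mdist Y (f x) (f x') = mdist X x x'" if "x \<in> mspace X" "x' \<in> mspace X" for x x'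
  proof (cases "x = x'")
    case True
    then show ?thesis
      using that fmem by (metis mdist_zero)
  next
    case False
    have e: "fibre_dist Y B (f x, b) (f x', b) = mdist X x x'"
      using iso[of "(x, b)" "(x', b)"] eq that b False by (simp add: fibre_dist_def)
    \<comment> \<open>If the images agreed, the left side of \<open>e\<close> would be the distance
      from \<open>b\<close> to itself, hence zero, whereas \<open>x\<close> and \<open>x'\<close>
      are distinct.\<close>
    then have "f x \<noteq> f x'"
      using that b fmem False mdist_zero[of x X x'] by (auto simp: fibre_dist_def)
    then show ?thesis
      using e that b fmem by (simp add: fibre_dist_def)
  qed
  then have "isometric_embedding X Y f"
    using fmem by (auto simp: isometric_embedding_def)
  moreover have "f \<in> extensional (mspace X)"
    by (simp add: f_def)
  ultimately show thesis
    using eq that by blast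
qed

section \<open>Functoriality, faithfulness, fullness and injectivity on objects\<close>

lemma categorical_full_embedding_U:
  fixes B :: "'b metric" and D :: "real set"
  assumes thin: "\<And>X :: 'a metric. X \<in> ultra_objects D \<Longrightarrow> thin_fibres X B \<delta>"
    and "mcomplete_of B" "strongly_rigid B" "mspace B \<noteq> {}"
    and "D \<subseteq> D'" "distance_set B \<subseteq> D'"
  shows "categorical_full_embedding
    (ultra_cat D :: ('a metric, 'a marrow) precat) (ultra_cat D') (U_obj B) (U_arr B)"
proof -
  note msp = thin_fibres.mspace_U_obj[OF thin]
  have obj: "U_obj B X \<in> ultra_objects D'" if X: "X \<in> ultra_objects D" for X :: "'a metric"
  proof -
    interpret thin_fibres X B \<delta>
      using thin X .
    have "distance_set (U_obj B X) \<subseteq> D'"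
      using distance_set_U_obj X assms(5,6) by (auto simp: ultra_objects_def)
    then show ?thesis
      using X assms(4) mcomplete_U_obj[OF assms(2)] ultrametric_U_obj canonical_U_obj
      by (simp add: ultra_objects_def)
  qed
  have "is_functor (ultra_cat D :: ('a metric, 'a marrow) precat) (ultra_cat D') (U_obj B) (U_arr B)"
    unfolding is_functor_def
  proof (intro conjI ballI impI)
    show "is_category (ultra_cat D)" "is_category (ultra_cat D')"
      by (rule is_category_ultra_cat)+
  next
    fix X :: "'a metric" assume "X \<in> Obj (ultra_cat D)"
    then have X: "X \<in> ultra_objects D"
      by (simp add: ultra_cat_def)
    then show "U_obj B X \<in> Obj (ultra_cat D')"
      by (simp add: ultra_cat_def obj)
    show "U_arr B (Ident (ultra_cat D) X) = Ident (ultra_cat D') (U_obj B X)"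
      using X by (auto simp: ultra_cat_def U_arr_def msp fun_eq_iff)
  next
    fix a :: "'a marrow" assume "a \<in> Arr (ultra_cat D)"
    then show "U_arr B a \<in> Hom (ultra_cat D') (U_obj B (Dom (ultra_cat D) a)) (U_obj B (Cod (ultra_cat D) a))"
      using isometric_embedding_U_arr[OF thin thin]
      by (auto simp: Hom_def ultra_cat_def U_arr_def obj msp)
  next
    fix a c :: "'a marrow"
    assume "a \<in> Arr (ultra_cat D)" "c \<in> Arr (ultra_cat D)" "Dom (ultra_cat D) c = Cod (ultra_cat D) a"
    then show "U_arr B (Comp (ultra_cat D) c a) = Comp (ultra_cat D') (U_arr B c) (U_arr B a)"
      by (auto simp: ultra_cat_def U_arr_def msp fun_eq_iff compose_def isometric_embedding_def Pi_def)
  qed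
  moreover have "faithful_on_homs (ultra_cat D :: ('a metric, 'a marrow) precat) (U_arr B)"
    unfolding faithful_on_homs_def
  proof (intro ballI inj_onI)
    fix X Y :: "'a metric" and a c :: "'a marrow"
    assume a: "a \<in> Hom (ultra_cat D) X Y" and c: "c \<in> Hom (ultra_cat D) X Y"
      and eq: "U_arr B a = U_arr B c"
    obtain f where f: "a = (X, f, Y)" "f \<in> extensional (mspace X)"
      using a by (auto simp: Hom_def ultra_cat_def)
    obtain g where g: "c = (X, g, Y)" "g \<in> extensional (mspace X)"
      using c by (auto simp: Hom_def ultra_cat_def)
    obtain b where b: "b \<in> mspace B"
      using assms(4) by blast
    have "restrict (\<lambda>(x, y). (f x, y)) (mspace X \<times> mspace B)
        = restrict (\<lambda>(x, y). (g x, y)) (mspace X \<times> mspace B)"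
      using eq by (simp add: U_arr_def f g)
    then have "f x = g x" if "x \<in> mspace X" for x
      using that b by (auto dest: fun_cong[of _ _ "(x, b)"])
    then show "a = c"
      using f g extensionalityI by blast
  qed
  moreover have "full_on_homs (ultra_cat D :: ('a metric, 'a marrow) precat) (ultra_cat D') (U_obj B) (U_arr B)"
    unfolding full_on_homs_def
  proof (intro ballI subsetI)
    fix X Y :: "'a metric" and c
    assume "X \<in> Obj (ultra_cat D)" "Y \<in> Obj (ultra_cat D)"
      and c: "c \<in> Hom (ultra_cat D') (U_obj B X) (U_obj B Y)"
    then have X: "X \<in> ultra_objects D" and Y: "Y \<in> ultra_objects D"
      by (simp_all add: ultra_cat_def)
    obtain \<phi> where \<phi>: "c = (U_obj B X, \<phi>, U_obj B Y)" "isometric_embedding (U_obj B X) (U_obj B Y) \<phi>"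
      "\<phi> \<in> extensional (mspace X \<times> mspace B)"
      using c msp[OF X] by (auto simp: Hom_def ultra_cat_def)
    obtain f where f: "isometric_embedding X Y f" "f \<in> extensional (mspace X)"
      "\<And>x y. \<lbrakk>x \<in> mspace X; y \<in> mspace B\<rbrakk> \<Longrightarrow> \<phi> (x, y) = (f x, y)"
      using isometric_embedding_U_obj_cases[OF thin[OF X] thin[OF Y] assms(3,4) \<phi>(2)] by blast
    have "\<phi> = restrict (\<lambda>(x, y). (f x, y)) (mspace X \<times> mspace B)"
      by (rule extensionalityI[OF \<phi>(3)]) (auto simp: f(3))
    then have "c = U_arr B (X, f, Y)"
      by (simp add: \<phi>(1) U_arr_def)
    moreover have "(X, f, Y) \<in> Hom (ultra_cat D) X Y"
      using X Y f by (simp add: Hom_def ultra_cat_def)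
    ultimately show "c \<in> U_arr B ` Hom (ultra_cat D) X Y"
      by blast
  qed
  moreover have "inj_on (U_obj B) (Obj (ultra_cat D :: ('a metric, 'a marrow) precat))"
  proof (rule inj_onI)
    fix X Y :: "'a metric"
    assume "X \<in> Obj (ultra_cat D)" "Y \<in> Obj (ultra_cat D)" "U_obj B X = U_obj B Y"
    then show "X = Y"
      using U_obj_eqD[OF thin thin assms(4)] by (auto simp: ultra_cat_def ultra_objects_def)
  qed
  ultimately show ?thesis
    unfolding categorical_full_embedding_def by blast
qed

section \<open>Application with threshold \<open>r 0\<close>\<close>

theorem theorem4p2:
  fixes D D' :: "real set"
    and r :: "nat \<Rightarrow> real"
    and Ubar :: "'b metric"
  assumes "D \<subseteq> D'"
    and "D' \<subseteq> {0<..}"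
    and "(INF x\<in>D. ereal x) > 0"
    and "(INF x\<in>D'. ereal x) = 0"
    and "range r \<subseteq> D'"
    and "\<forall>m n. m < n \<longrightarrow> r n < r m"
    and "\<forall>x\<in>D'. \<exists>n. r n \<le> x"
    and "ereal (r 0) < (INF x\<in>D. ereal x)"
    and "ultrametric Ubar"
    and "polish_metric Ubar"
    and "compact_space (mtopology_of Ubar)"
    and "perfect_topology (mtopology_of Ubar)"
    and "strongly_rigid Ubar"
    and "distance_set Ubar = range r"
  shows
    "categorical_full_embedding
        (ultra_cat D :: ('a metric, 'a marrow) precat)
        (ultra_cat D' :: (('a \<times> 'b) metric, ('a \<times> 'b) marrow) precat)
        (U_obj Ubar) (U_arr Ubar) \<and>
     (\<forall>X \<in> Obj (ultra_cat D :: ('a metric, 'a marrow) precat).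
        perfect_topology (mtopology_of (U_obj Ubar X)) \<and>
        locally_compact_space (mtopology_of (U_obj Ubar X)) \<and>
        weight (mtopology_of (U_obj Ubar X)) =o card_max |mspace X| natLeq)"
proof -
  have r_le: "r n \<le> r 0" for n
    using assms(6) by (cases n) (auto intro: less_imp_le)
  have r_pos: "0 < r n" for n
    using assms(2,5) by auto
  \<comment> \<open>The threshold is the largest distance \<open>r 0\<close> of \<open>Ubar\<close>;
    nonzero distances of \<open>X\<close> lie in \<open>D\<close>, whose infimum exceeds
    \<open>r 0\<close>.\<close>
  have thin: "thin_fibres X Ubar (r 0)" if X: "X \<in> ultra_objects D" for X :: "'a metric"
  proof
    show "ultrametric X" "ultrametric Ubar" "0 < r 0"
      using X assms(9) r_pos by (auto simp: ultra_objects_def)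
    show "mdist Ubar y y' \<le> r 0" if "y \<in> mspace Ubar" "y' \<in> mspace Ubar" for y y'
    proof (cases "y = y'")
      case True
      then show ?thesis
        using that r_pos[of 0] mdist_zero[of y Ubar y'] by linarith
    next
      case False
      then have "mdist Ubar y y' \<in> distance_set Ubar"
        using that by (auto simp: distance_set_def)
      then show ?thesis
        using assms(14) r_le by auto
    qed
    show "r 0 < mdist X x x'" if "x \<in> mspace X" "x' \<in> mspace X" "x \<noteq> x'" for x x'
    proof -
      have "mdist X x x' \<in> distance_set X"
        using that by (auto simp: distance_set_def)
      then have "mdist X x x' \<in> D"
        using X by (auto simp: ultra_objects_def)
      then have "(INF x\<in>D. ereal x) \<le> ereal (mdist X x x')"
        by (rule INF_lower)
      then show ?thesis
        using assms(8) by (metis less_ereal.simps(1) order_less_le_trans)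
    qed
  qed
  \<comment> \<open>Strict decrease gives infinitely many distances, which finitely many points
    could not realise; so \<open>Ubar\<close> is infinite, as the weight computation requires, and
    in particular nonempty.\<close>
  have "inj r"
    using assms(6) by (metis injI less_irrefl nat_neq_iff)
  then have "infinite (distance_set Ubar)"
    using assms(14) finite_imageD by auto
  moreover have "distance_set Ubar \<subseteq> (\<lambda>(y, y'). mdist Ubar y y') ` (mspace Ubar \<times> mspace Ubar)"
    by (auto simp: distance_set_def)
  ultimately have inf: "infinite (mspace Ubar)"
    by (meson finite_SigmaI finite_imageI finite_subset)
  then have ne: "mspace Ubar \<noteq> {}"
    by auto
  have polish: "mcomplete_of Ubar" "separable_space (mtopology_of Ubar)"
    using assms(10) by (auto simp: polish_metric_def)
  have "perfect_topology (mtopology_of (U_obj Ubar X)) \<and>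
        locally_compact_space (mtopology_of (U_obj Ubar X)) \<and>
        weight (mtopology_of (U_obj Ubar X)) =o card_max |mspace X| natLeq"
    if "X \<in> Obj (ultra_cat D)" for X :: "'a metric"
  proof -
    have X: "X \<in> ultra_objects D" "mspace X \<noteq> {}"
      using that by (auto simp: ultra_cat_def ultra_objects_def)
    interpret thin_fibres X Ubar "r 0"
      using thin X(1) .
    show ?thesis
      using perfect_U_obj locally_compact_U_obj weight_U_obj assms(11,12) polish(2) inf X(2) by blast
  qed
  moreover have "categorical_full_embedding
        (ultra_cat D :: ('a metric, 'a marrow) precat) (ultra_cat D') (U_obj Ubar) (U_arr Ubar)"
    using categorical_full_embedding_U[OF thin polish(1) assms(13) ne assms(1)] assms(5,14) by simp
  ultimately show ?thesis
    by blast
qed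

end
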